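(* Let $f(n)$ be the largest integer such that every poset on $n$ elements has a subposet on $f(n)$ elements of dimension at most $2$. Then \[ f(n) \leq 4n^{2/3} + o\left(n^{2/3}\right) \quad (n\to\infty). \]
   Context: A subposet of a poset $P$ is a subset of its ground set with the order induced from $P$. The dimension $\dim(P)$ of a poset $P$ is the least integer $d$ such that there are $d$ linear extensions of $P$ whose intersection is $P$ (equivalently, the least $d$ such that $P$ embeds into $\mathbb{R}^d$ with the product order, i.e. $x<y$ in $P$ iff the image of $x$ is coordinatewise below the image of $y$). *)

theory Defs
  imports Complex_Main "HOL-Library.Landau_Symbols"
begin

definition poset_on :: "'a set \<Rightarrow> ('a \<Rightarrow> 'a \<Rightarrow> bool) \<Rightarrow> bool" where
  "poset_on S R \<longleftrightarrow>
     (\<forall>x\<in>S. R x x) \<and>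
     (\<forall>x\<in>S. \<forall>y\<in>S. R x y \<and> R y x \<longrightarrow> x = y) \<and>
     (\<forall>x\<in>S. \<forall>y\<in>S. \<forall>z\<in>S. R x y \<and> R y z \<longrightarrow> R x z)"

definition linear_extension :: "'a set \<Rightarrow> ('a \<Rightarrow> 'a \<Rightarrow> bool) \<Rightarrow> ('a \<Rightarrow> 'a \<Rightarrow> bool) \<Rightarrow> bool" where
  "linear_extension S R L \<longleftrightarrow>
     poset_on S L \<and> (\<forall>x\<in>S. \<forall>y\<in>S. L x y \<or> L y x) \<and>
     (\<forall>x\<in>S. \<forall>y\<in>S. R x y \<longrightarrow> L x y)"

definition order_dim :: "'a set \<Rightarrow> ('a \<Rightarrow> 'a \<Rightarrow> bool) \<Rightarrow> nat" where
  "order_dim S R = (LEAST d. \<exists>Ls. length Ls = d \<and>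
       (\<forall>L\<in>set Ls. linear_extension S R L) \<and>
       (\<forall>x\<in>S. \<forall>y\<in>S. R x y \<longleftrightarrow> (\<forall>L\<in>set Ls. L x y)))"

definition f_sub2 :: "nat \<Rightarrow> nat" where
  "f_sub2 n = Max {k. \<forall>R. poset_on {0..<n} R \<longrightarrow>
       (\<exists>T. T \<subseteq> {0..<n} \<and> card T = k \<and> order_dim T R \<le> 2)}"

end

theory Submission
  imports Defs "HOL-Real_Asymp.Real_Asymp"
begin

text \<open>
  Order the grid $[m]^3$ by letting $p < q$ iff $p \<le> q$ coordinatewise and $p$, $q$ differ in at
  least two coordinates, so that axis-parallel lines are antichains. From a set of more than
  $4m^2$ points delete the largest point of every x-line and the smallest point of every
  y-line, and then twice the largest remaining point of every z-line. Something survives, so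
  there are points $c_1, c_2, c_3$ upwards on one z-line, points $d_1, d_2$ below $c_1, c_2$ on
  their y-lines, and points $g_2, g_3$ above $c_2, c_3$ on their x-lines.

  In a two-dimensional order one of three pairwise incomparable elements lies between the other
  two: it is above every common lower bound and below every common upper bound of them. The
  element $d_1$ shows that this is not $c_1$, and $g_3$ that it is not $c_3$. If it is $c_2$, then
  in one of the two linear orders $d_2$ is above $c_2$ and $g_2$ below $c_2$, although $d_2 < g_2$.
\<close>

section \<open>Realizers by two linear extensions, and counting fibre maxima\<close>

lemma linear_extensionD:
  assumes "linear_extension S R L" "x \<in> S" "y \<in> S"
  shows "L x y \<or> L y x" "z \<in> S \<Longrightarrow> L x y \<Longrightarrow> L y z \<Longrightarrow> L x z" "R x y \<Longrightarrow> L x y"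
  using assms unfolding linear_extension_def poset_on_def by blast+

text \<open>The existence of some realizer has to be assumed, as otherwise \<^const>\<open>order_dim\<close> is the
  \<^const>\<open>Least\<close> of an empty predicate.\<close>

lemma two_realizer_if_order_dim_le_2:
  assumes "poset_on S R"
    and "\<forall>L\<in>set Ls. linear_extension S R L"
    and "\<forall>x\<in>S. \<forall>y\<in>S. R x y \<longleftrightarrow> (\<forall>L\<in>set Ls. L x y)"
    and dim: "order_dim S R \<le> 2"
  obtains L M where "linear_extension S R L" "linear_extension S R M"
    "\<And>x y. x \<in> S \<Longrightarrow> y \<in> S \<Longrightarrow> R x y \<longleftrightarrow> L x y \<and> M x y"
proof -
  let ?P = "\<lambda>d. \<exists>Ls. length Ls = d \<and> (\<forall>L\<in>set Ls. linear_extension S R L) \<and>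
       (\<forall>x\<in>S. \<forall>y\<in>S. R x y \<longleftrightarrow> (\<forall>L\<in>set Ls. L x y))"
  have "?P (length Ls)"
    using assms by blast
  then have "?P (order_dim S R)"
    unfolding order_dim_def by (rule LeastI)
  then obtain Ks where Ks: "length Ks = order_dim S R"
      "\<forall>L\<in>set Ks. linear_extension S R L"
      "\<forall>x\<in>S. \<forall>y\<in>S. R x y \<longleftrightarrow> (\<forall>L\<in>set Ks. L x y)"
    by blast
  consider "Ks = []" | L where "Ks = [L]" | L M where "Ks = [L, M]"
    using dim unfolding Ks(1)[symmetric] by (cases Ks rule: remdups_adj.cases) auto
  then show thesis
  proof cases
    case 1
    \<comment> \<open>The empty list can only realize the total relation, so \<open>R\<close> is its
      own linear extension and serves as both orders.\<close>
    then have "\<And>x y. x \<in> S \<Longrightarrow> y \<in> S \<Longrightarrow> R x y"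
      using Ks(3) by simp
    moreover from this have "linear_extension S R R"
      using \<open>poset_on S R\<close> by (simp add: linear_extension_def)
    ultimately show thesis
      using that by blast
  next
    case (2 L)
    then show thesis
      using Ks that[of L L] by simp
  next
    case (3 L M)
    then show thesis
      using Ks that[of L M] by simp
  qed
qed

text \<open>Two maxima in one fibre of \<open>\<pi>\<close> have equal \<open>h\<close>, since
  \<open>h\<close> takes values in a linear order, and so coincide. Hence \<open>\<pi>\<close> is
  injective on the maxima.\<close>

lemma card_fibre_maxima_le:
  fixes h :: "'a \<Rightarrow> 'b::linorder"
  assumes "finite B" "\<pi> ` A \<subseteq> B" "inj_on (\<lambda>p. (\<pi> p, h p)) A"
  shows "card {p \<in> A. \<not> (\<exists>q\<in>A. \<pi> q = \<pi> p \<and> h p < h q)} \<le> card B"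
proof (rule card_inj_on_le)
  show "inj_on \<pi> {p \<in> A. \<not> (\<exists>q\<in>A. \<pi> q = \<pi> p \<and> h p < h q)}"
    using assms(3) by (auto simp: inj_on_def) (metis linorder_neqE)
qed (use assms in auto)

section \<open>The grid order and three lexicographic extensions of it\<close>

definition off_axis_le :: "('a \<Rightarrow> nat) \<Rightarrow> ('a \<Rightarrow> nat) \<Rightarrow> ('a \<Rightarrow> nat) \<Rightarrow> 'a \<Rightarrow> 'a \<Rightarrow> bool" where
  "off_axis_le X Y Z p q \<longleftrightarrow> p = q \<or>
     X p \<le> X q \<and> Y p \<le> Y q \<and> Z p \<le> Z q \<and>
     \<not> (X p = X q \<and> Y p = Y q) \<and> \<not> (X p = X q \<and> Z p = Z q) \<and> \<not> (Y p = Y q \<and> Z p = Z q)"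

text \<open>Lexicographic in \<open>a\<close>, then \<open>b\<close>, but decreasing along lines in
  direction \<open>c\<close>. Letting each axis be reversed once makes every axis-parallel line an
  antichain of the intersection.\<close>

definition lex_le :: "('a \<Rightarrow> nat) \<Rightarrow> ('a \<Rightarrow> nat) \<Rightarrow> ('a \<Rightarrow> nat) \<Rightarrow> 'a \<Rightarrow> 'a \<Rightarrow> bool" where
  "lex_le a b c p q \<longleftrightarrow>
     a p < a q \<or> a p = a q \<and> (b p < b q \<or> b p = b q \<and> c q \<le> c p)"

lemma linear_extension_lex_le:
  assumes "\<And>p q. p \<in> S \<Longrightarrow> q \<in> S \<Longrightarrow> a p = a q \<Longrightarrow> b p = b q \<Longrightarrow> c p = c q \<Longrightarrow> p = q"
    and "\<And>p q. p \<in> S \<Longrightarrow> q \<in> S \<Longrightarrow> R p q \<Longrightarrow> lex_le a b c p q"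
  shows "linear_extension S R (lex_le a b c)"
proof -
  have "lex_le a b c p q \<or> lex_le a b c q p" for p q
    by (auto simp: lex_le_def)
  moreover have "p = q" if "p \<in> S" "q \<in> S" "lex_le a b c p q" "lex_le a b c q p" for p q
  proof -
    have "a p = a q \<and> b p = b q \<and> c p = c q"
      using that(3,4) unfolding lex_le_def by (elim disjE conjE; simp)
    then show ?thesis
      using that assms(1) by blast
  qed
  moreover have "lex_le a b c p r" if "lex_le a b c p q" "lex_le a b c q r" for p q r
    using that unfolding lex_le_def by (elim disjE conjE; simp)
  ultimately show ?thesis
    using assms(2) unfolding linear_extension_def poset_on_def by blast
qed

text \<open>Coordinates are functions on an arbitrary type, so that natural numbers can later act as
  grid points through their digits.\<close>

locale grid_coordinates =
  fixes S :: "'a set" and X Y Z :: "'a \<Rightarrow> nat"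
  assumes eqI: "p \<in> S \<Longrightarrow> q \<in> S \<Longrightarrow> X p = X q \<Longrightarrow> Y p = Y q \<Longrightarrow> Z p = Z q \<Longrightarrow> p = q"
begin

abbreviation le :: "'a \<Rightarrow> 'a \<Rightarrow> bool" where
  "le \<equiv> off_axis_le X Y Z"

text \<open>Distinct related points differ in two coordinates, hence in one of the first two keys,
  and the reversed third key is never consulted.\<close>

lemma le_imp_lex:
  assumes "le p q"
  shows "lex_le X Z Y p q" "lex_le Y X Z p q" "lex_le Z Y X p q"
  using assms unfolding off_axis_le_def lex_le_def
  by (elim disjE; simp; simp only: le_less; blast)+

lemma le_iff_lex:
  assumes "p \<in> S" "q \<in> S"
  shows "le p q \<longleftrightarrow> lex_le X Z Y p q \<and> lex_le Y X Z p q \<and> lex_le Z Y X p q"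
proof
  assume "lex_le X Z Y p q \<and> lex_le Y X Z p q \<and> lex_le Z Y X p q"
  then show "le p q"
    using eqI[OF assms] unfolding off_axis_le_def lex_le_def by (elim disjE conjE; simp)
qed (blast intro: le_imp_lex)

lemma linear_extension_lex:
  "linear_extension S le (lex_le X Z Y)"
  "linear_extension S le (lex_le Y X Z)"
  "linear_extension S le (lex_le Z Y X)"
  by (rule linear_extension_lex_le; blast intro: eqI le_imp_lex)+

lemma poset_on_le: "poset_on S le"
proof -
  have "poset_on S (lex_le X Z Y)" "poset_on S (lex_le Y X Z)" "poset_on S (lex_le Z Y X)"
    using linear_extension_lex by (auto simp: linear_extension_def)
  then show ?thesis
    using le_iff_lex unfolding poset_on_def by meson
qed

section \<open>The forbidden configuration and the bound \<open>4 * m\<^sup>2\<close>\<close>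

lemma no_two_realizer:
  assumes L: "linear_extension S le L" and M: "linear_extension S le M"
    and LM: "\<And>p q. p \<in> S \<Longrightarrow> q \<in> S \<Longrightarrow> le p q \<longleftrightarrow> L p q \<and> M p q"
    and S: "c1 \<in> S" "c2 \<in> S" "c3 \<in> S" "d1 \<in> S" "d2 \<in> S" "g2 \<in> S" "g3 \<in> S"
    and c: "X c1 = X c2" "X c3 = X c2" "Y c1 = Y c2" "Y c3 = Y c2" "Z c1 < Z c2" "Z c2 < Z c3"
    and d: "X d1 = X c1" "Z d1 = Z c1" "Y d1 < Y c1" "X d2 = X c2" "Z d2 = Z c2" "Y d2 < Y c2"
    and g: "Y g2 = Y c2" "Z g2 = Z c2" "X c2 < X g2" "Y g3 = Y c3" "Z g3 = Z c3" "X c3 < X g3"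
  shows False
proof -
  have le: "le d1 c2" "le d1 c3" "le c1 g3" "le c2 g3" "le d2 c3" "le c1 g2" "le d2 g2"
    using c d g by (auto simp: off_axis_le_def)
  have nle: "\<not> le c1 c2" "\<not> le c2 c1" "\<not> le c1 c3" "\<not> le c3 c1" "\<not> le c2 c3" "\<not> le c3 c2"
    "\<not> le d1 c1" "\<not> le c3 g3" "\<not> le d2 c2" "\<not> le c2 g2"
    using c d g by (auto simp: off_axis_le_def)
  \<comment> \<open>The two extensions are symmetric, so \<open>L\<close> may be taken to be the one
    with \<open>c1\<close> below \<open>c2\<close>.\<close>
  have aux: False
    if L: "linear_extension S le L" and M: "linear_extension S le M"
      and LM: "\<And>p q. p \<in> S \<Longrightarrow> q \<in> S \<Longrightarrow> le p q \<longleftrightarrow> L p q \<and> M p q"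
      and "L c1 c2" for L M
  proof -
    note total = linear_extensionD(1)[OF L] linear_extensionD(1)[OF M]
    note Lt = linear_extensionD(2)[OF L] and Mt = linear_extensionD(2)[OF M]
    note Le = linear_extensionD(3)[OF L] and Me = linear_extensionD(3)[OF M]
    have M21: "M c2 c1"
      using LM[of c1 c2] nle S total(2)[of c1 c2] \<open>L c1 c2\<close> by blast
    \<comment> \<open>Otherwise \<open>c1\<close> lies between \<open>c3\<close> and
      \<open>c2\<close>, which forces their lower bound \<open>d1\<close> below it.\<close>
    have "L c1 c3"
    proof (rule ccontr)
      assume "\<not> L c1 c3"
      then have "L c3 c1"
        using total S by blast
      then have "L d1 c1"
        using Lt[of d1 c3 c1] Le[of d1 c3] le S by blast
      moreover have "M d1 c1"
        using Mt[of d1 c2 c1] Me[of d1 c2] le S M21 by blast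
      ultimately show False
        using LM[of d1 c1] nle S by blast
    qed
    then have M31: "M c3 c1"
      using LM[of c1 c3] nle S total(2)[of c1 c3] by blast
    \<comment> \<open>Otherwise \<open>c3\<close> lies between \<open>c1\<close> and
      \<open>c2\<close>, which forces their upper bound \<open>g3\<close> above it.\<close>
    have "L c2 c3"
    proof (rule ccontr)
      assume "\<not> L c2 c3"
      then have "L c3 c2"
        using total S by blast
      then have "L c3 g3"
        using Lt[of c3 c2 g3] Le[of c2 g3] le S by blast
      moreover have "M c3 g3"
        using Mt[of c3 c1 g3] Me[of c1 g3] le S M31 by blast
      ultimately show False
        using LM[of c3 g3] nle S by blast
    qed
    then have M32: "M c3 c2"
      using LM[of c2 c3] nle S total(2)[of c2 c3] by blast
    \<comment> \<open>Now \<open>c2\<close> is the middle element. As \<open>d2\<close> is below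
      \<open>c2\<close> in \<open>M\<close>, it is above \<open>c2\<close> in \<open>L\<close>, and
      \<open>g2\<close> above \<open>d2\<close> then ends up above \<open>c2\<close> in both
      orders.\<close>
    have "M d2 c2"
      using Mt[of d2 c3 c2] Me[of d2 c3] le S M32 by blast
    then have "L c2 d2"
      using LM[of d2 c2] nle S total(1)[of d2 c2] by blast
    then have "L c2 g2"
      using Lt[of c2 d2 g2] Le[of d2 g2] le S by blast
    moreover have "M c2 g2"
      using Mt[of c2 c1 g2] Me[of c1 g2] le S M21 by blast
    ultimately show False
      using LM[of c2 g2] nle S by blast
  qed
  have "L c1 c2 \<or> M c1 c2"
  proof (rule ccontr)
    assume "\<not> (L c1 c2 \<or> M c1 c2)"
    then have "L c2 c1" "M c2 c1"
      using linear_extensionD(1)[OF L] linear_extensionD(1)[OF M] S by blast+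
    then show False
      using LM[of c2 c1] nle S by blast
  qed
  then show False
  proof
    assume "L c1 c2"
    with L M LM show False
      by (rule aux)
  next
    assume "M c1 c2"
    moreover have "le p q \<longleftrightarrow> M p q \<and> L p q" if "p \<in> S" "q \<in> S" for p q
      using LM that by blast
    ultimately show False
      using M L by (intro aux)
  qed
qed

lemma card_le_if_two_realizer:
  assumes L: "linear_extension S le L" and M: "linear_extension S le M"
    and LM: "\<And>p q. p \<in> S \<Longrightarrow> q \<in> S \<Longrightarrow> le p q \<longleftrightarrow> L p q \<and> M p q"
    and "finite S" and bounds: "\<And>p. p \<in> S \<Longrightarrow> X p < m \<and> Y p < m \<and> Z p < m"
  shows "card S \<le> 4 * m\<^sup>2"
proof -
  define xtop where "xtop = {p \<in> S. \<not> (\<exists>q\<in>S. (Y q, Z q) = (Y p, Z p) \<and> X p < X q)}"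
  \<comment> \<open>Negating \<open>Y\<close> turns smallest points into fibre maxima, so one
    counting lemma covers all four sets.\<close>
  define ybot where "ybot = {p \<in> S. \<not> (\<exists>q\<in>S. (X q, Z q) = (X p, Z p) \<and> - int (Y p) < - int (Y q))}"
  define U where "U = S - xtop - ybot"
  define ztop where "ztop = {p \<in> U. \<not> (\<exists>q\<in>U. (X q, Y q) = (X p, Y p) \<and> Z p < Z q)}"
  define V where "V = U - ztop"
  \<comment> \<open>Two rounds of deletion leave room for two further points above: a point of
    \<open>V\<close> outside \<open>ztop2\<close> has some \<open>c2\<close> in \<open>V\<close>
    above it, which in turn has some \<open>c3\<close> in \<open>U\<close> above it.\<close>
  define ztop2 where "ztop2 = {p \<in> V. \<not> (\<exists>q\<in>V. (X q, Y q) = (X p, Y p) \<and> Z p < Z q)}"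
  let ?B = "{..<m} \<times> {..<m}"
  have B: "finite ?B" "card ?B = m\<^sup>2"
    by (simp_all add: power2_eq_square)
  have sub: "U \<subseteq> S" "V \<subseteq> S"
    by (auto simp: U_def V_def)
  have xtop: "card xtop \<le> card ?B"
    unfolding xtop_def
    by (rule card_fibre_maxima_le) (use bounds in \<open>auto intro!: inj_onI eqI\<close>)
  have ybot: "card ybot \<le> card ?B"
    unfolding ybot_def
    by (rule card_fibre_maxima_le) (use bounds in \<open>auto intro!: inj_onI eqI\<close>)
  have ztop: "card ztop \<le> card ?B"
    unfolding ztop_def
    by (rule card_fibre_maxima_le) (use bounds sub in \<open>auto intro!: inj_onI eqI\<close>)
  have ztop2: "card ztop2 \<le> card ?B"
    unfolding ztop2_def
    by (rule card_fibre_maxima_le) (use bounds sub in \<open>auto intro!: inj_onI eqI\<close>)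
  have "S \<subseteq> xtop \<union> ybot \<union> ztop \<union> ztop2"
  proof
    fix c1 assume "c1 \<in> S"
    show "c1 \<in> xtop \<union> ybot \<union> ztop \<union> ztop2"
    proof (rule ccontr)
      assume "c1 \<notin> xtop \<union> ybot \<union> ztop \<union> ztop2"
      with \<open>c1 \<in> S\<close> have "c1 \<in> V" "c1 \<notin> ztop2"
        by (auto simp: V_def U_def)
      then obtain c2 where c2: "c2 \<in> V" "X c2 = X c1" "Y c2 = Y c1" "Z c1 < Z c2"
        by (auto simp: ztop2_def)
      then obtain c3 where c3: "c3 \<in> U" "X c3 = X c2" "Y c3 = Y c2" "Z c2 < Z c3"
        by (auto simp: V_def ztop_def)
      have U: "c1 \<in> U" "c2 \<in> U"
        using \<open>c1 \<in> V\<close> c2 by (auto simp: V_def)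
      have up: "\<exists>g\<in>S. Y g = Y p \<and> Z g = Z p \<and> X p < X g"
        and down: "\<exists>d\<in>S. X d = X p \<and> Z d = Z p \<and> Y d < Y p" if "p \<in> U" for p
        using that by (auto simp: U_def xtop_def ybot_def)
      obtain d1 where "d1 \<in> S" "X d1 = X c1" "Z d1 = Z c1" "Y d1 < Y c1"
        using down U by blast
      moreover obtain d2 where "d2 \<in> S" "X d2 = X c2" "Z d2 = Z c2" "Y d2 < Y c2"
        using down U by blast
      moreover obtain g2 where "g2 \<in> S" "Y g2 = Y c2" "Z g2 = Z c2" "X c2 < X g2"
        using up U by blast
      moreover obtain g3 where "g3 \<in> S" "Y g3 = Y c3" "Z g3 = Z c3" "X c3 < X g3"
        using up c3 by blast
      ultimately show False
        using no_two_realizer[OF L M LM, of c1 c2 c3 d1 d2 g2 g3] c2 c3 U sub by auto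
    qed
  qed
  moreover have "finite (xtop \<union> ybot \<union> ztop \<union> ztop2)"
    by (rule finite_subset[OF _ \<open>finite S\<close>])
      (use sub in \<open>auto simp: xtop_def ybot_def ztop_def ztop2_def\<close>)
  ultimately have "card S \<le> card (xtop \<union> ybot \<union> ztop \<union> ztop2)"
    by (intro card_mono)
  also have "\<dots> \<le> card xtop + card ybot + card ztop + card ztop2"
    by (meson add_le_mono1 card_Un_le order_trans)
  finally show ?thesis
    using xtop ybot ztop ztop2 B by linarith
qed

lemma card_le_if_order_dim_le_2:
  assumes "order_dim S le \<le> 2" "finite S"
    and "\<And>p. p \<in> S \<Longrightarrow> X p < m \<and> Y p < m \<and> Z p < m"
  shows "card S \<le> 4 * m\<^sup>2"
proof -
  \<comment> \<open>This realizer of length three ensures that \<open>order_dim\<close> is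
    attained.\<close>
  let ?Ls = "[lex_le X Z Y, lex_le Y X Z, lex_le Z Y X]"
  have "\<forall>L\<in>set ?Ls. linear_extension S le L"
    using linear_extension_lex by simp
  moreover have "\<forall>p\<in>S. \<forall>q\<in>S. le p q \<longleftrightarrow> (\<forall>L\<in>set ?Ls. L p q)"
    using le_iff_lex by simp
  ultimately obtain L M where "linear_extension S le L" "linear_extension S le M"
      "\<And>p q. p \<in> S \<Longrightarrow> q \<in> S \<Longrightarrow> le p q \<longleftrightarrow> L p q \<and> M p q"
    by (rule two_realizer_if_order_dim_le_2[OF poset_on_le _ _ assms(1)]) blast
  then show ?thesis
    using assms(2,3) by (rule card_le_if_two_realizer)
qed

end

section \<open>Transfer to \<open>{0..<n}\<close> and asymptotics\<close>

lemma grid_coordinates_digits: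
  "grid_coordinates T (\<lambda>i. i mod m) (\<lambda>i. i div m mod m) (\<lambda>i. i div m div m)"
  by unfold_locales (metis div_mult_mod_eq)

lemma f_sub2_le:
  assumes "n \<le> m ^ 3"
  shows "f_sub2 n \<le> 4 * m\<^sup>2"
proof -
  let ?K = "{k. \<forall>R. poset_on {0..<n} R \<longrightarrow>
       (\<exists>T. T \<subseteq> {0..<n} \<and> card T = k \<and> order_dim T R \<le> 2)}"
  \<comment> \<open>Base \<open>m\<close> digits place the numbers below \<open>m ^ 3\<close> in the
    grid; the leading digit is not reduced modulo \<open>m\<close>, so the digits determine every
    number.\<close>
  let ?R = "off_axis_le (\<lambda>i. i mod m) (\<lambda>i. i div m mod m) (\<lambda>i. i div m div m)"
  have poset: "poset_on {0..<n} ?R"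
    by (rule grid_coordinates.poset_on_le[OF grid_coordinates_digits])
  have "?K \<subseteq> {..n}"
  proof
    fix k assume "k \<in> ?K"
    then obtain T where "T \<subseteq> {0..<n}" "card T = k"
      using poset by blast
    then show "k \<in> {..n}"
      using card_mono[of "{0..<n}" T] by simp
  qed
  then have "finite ?K"
    by (rule finite_subset) simp
  \<comment> \<open>\<open>Max\<close> needs a nonempty set: the empty subset, realized by the empty
    list, contributes 0.\<close>
  moreover have "order_dim {} R = 0" for R :: "nat \<Rightarrow> nat \<Rightarrow> bool"
    unfolding order_dim_def by (intro Least_eq_0) simp
  then have "0 \<in> ?K"
    by (auto intro!: exI[of _ "{}"])
  ultimately have "f_sub2 n \<in> ?K"
    unfolding f_sub2_def using Max_in by blast
  then obtain T where T: "T \<subseteq> {0..<n}" "card T = f_sub2 n" "order_dim T ?R \<le> 2"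
    using poset by blast
  have "i mod m < m \<and> i div m mod m < m \<and> i div m div m < m" if "i \<in> T" for i
  proof -
    have "i < m * m * m"
      using that T(1) assms by (auto simp: power3_eq_cube)
    then show ?thesis
      by (cases "m = 0") (auto simp: less_mult_imp_div_less)
  qed
  then show ?thesis
    using grid_coordinates.card_le_if_order_dim_le_2[OF grid_coordinates_digits T(3)]
      finite_subset[OF T(1)] T(2) by simp
qed

theorem theorem1:
  "\<exists>h :: nat \<Rightarrow> real. h \<in> o(\<lambda>n. real n powr (2/3)) \<and>
     (\<forall>n. real (f_sub2 n) \<le> 4 * real n powr (2/3) + h n)"
proof (intro exI conjI allI)
  \<comment> \<open>Rounding the side \<open>r\<close> up to \<open>m\<close> costs at most
    \<open>4 * (r + 1)\<^sup>2 - 4 * r\<^sup>2 = 8 * r + 4\<close>.\<close>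
  show "(\<lambda>n. 8 * real n powr (1/3) + 4) \<in> o(\<lambda>n. real n powr (2/3))"
    by real_asymp
  fix n :: nat
  define r where "r = real n powr (1/3)"
  define m where "m = nat \<lceil>r\<rceil>"
  have r: "r \<ge> 0" "r ^ 3 = real n" "r\<^sup>2 = real n powr (2/3)"
    by (cases "n = 0"; simp add: r_def powr_power)+
  have m: "r \<le> real m" "real m \<le> r + 1"
    using r(1) unfolding m_def by linarith+
  have "real n \<le> real (m ^ 3)"
    using power_mono[OF m(1) r(1), of 3] r(2) by simp
  then have "real (f_sub2 n) \<le> real (4 * m\<^sup>2)"
    using f_sub2_le by (simp only: of_nat_le_iff)
  also have "\<dots> \<le> 4 * (r + 1)\<^sup>2"
    using power_mono[OF m(2), of 2] by simp
  also have "\<dots> = 4 * r\<^sup>2 + (8 * r + 4)"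
    by (simp add: power2_eq_square algebra_simps)
  finally show "real (f_sub2 n) \<le> 4 * real n powr (2/3) + (8 * real n powr (1/3) + 4)"
    by (simp only: flip: r(3) r_def)
qed

end
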